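(* For integers $a \geq 3$ and $n \ge a$, the function $\mathrm{gex}(n;a)$ is bounded above in terms of the Ramsey number $R(a,a+1)$ by $$\mathrm{gex}(n;a) \leq \frac{R(a,a+1)-1}{2}\, n.$$
   Context: All graphs are finite, simple and undirected; the order of a graph is its number of vertices and its size is its number of edges. A geodesic is a shortest path between two vertices. A set $S$ of vertices of a graph $G$ is in general position if no geodesic of $G$ contains more than two elements of $S$; the general position number (gp-number) is the largest size of such a set. For $a \geq 2$ and $n \geq a$, $\mathrm{gex}(n;a)$ is the largest possible size of a graph with order $n$ and gp-number $a$. The Ramsey number $R(s,t)$ is the smallest $N$ such that every graph of order $N$ contains a clique of size $s$ or an independent set of size $t$. *)

theory Defs
  imports Complex_Main "HOL-Library.Ramsey"
begin

text \<open>A finite simple undirected graph is given by its vertex set and its set of edges, each edge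
  being a two-element set of vertices (\<^term>\<open>[V]\<^bsup>2\<^esup>\<close> is the set of two-element
  subsets of \<^term>\<open>V\<close>). This matches \<^const>\<open>clique\<close> and \<^const>\<open>indep\<close>
  of the imported theory. Graphs are not assumed to be connected.\<close>

definition simple_graph :: "'a set \<Rightarrow> 'a set set \<Rightarrow> bool" where
  "simple_graph V E \<longleftrightarrow> finite V \<and> E \<subseteq> [V]\<^bsup>2\<^esup>"

text \<open>A path is the nonempty list of its pairwise distinct vertices, so that a single vertex is a
  path of length zero, and the number of edges of a path is one less than the length of the list.\<close>

definition path_between :: "'a set \<Rightarrow> 'a set set \<Rightarrow> 'a \<Rightarrow> 'a \<Rightarrow> 'a list \<Rightarrow> bool" where
  "path_between V E u v p \<longleftrightarrow>
     p \<noteq> [] \<and> hd p = u \<and> last p = v \<and> set p \<subseteq> V \<and> distinct p \<and>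
     (\<forall>i. Suc i < length p \<longrightarrow> {p ! i, p ! Suc i} \<in> E)"

definition geodesic :: "'a set \<Rightarrow> 'a set set \<Rightarrow> 'a list \<Rightarrow> bool" where
  "geodesic V E p \<longleftrightarrow>
     (\<exists>u v. path_between V E u v p \<and> (\<forall>q. path_between V E u v q \<longrightarrow> length p \<le> length q))"

definition general_position :: "'a set \<Rightarrow> 'a set set \<Rightarrow> 'a set \<Rightarrow> bool" where
  "general_position V E S \<longleftrightarrow>
     S \<subseteq> V \<and> (\<forall>p. geodesic V E p \<longrightarrow> card (S \<inter> set p) \<le> 2)"

definition gp_number :: "'a set \<Rightarrow> 'a set set \<Rightarrow> nat" where
  "gp_number V E = Max {card S | S. general_position V E S}"

text \<open>Since every finite graph is isomorphic to one whose vertices are natural numbers, the extremal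
  function and the Ramsey number only need to range over such graphs.\<close>

definition gex :: "nat \<Rightarrow> nat \<Rightarrow> nat" where
  "gex n a = Max {card E | (V :: nat set) E.
     simple_graph V E \<and> card V = n \<and> gp_number V E = a}"

definition ramsey_number :: "nat \<Rightarrow> nat \<Rightarrow> nat" where
  "ramsey_number s t = (LEAST N. \<forall>(V :: nat set) E. simple_graph V E \<and> card V = N \<longrightarrow>
     (\<exists>S \<subseteq> V. card S = s \<and> clique S E \<or> card S = t \<and> indep S E))"

end

theory Submission
  imports Defs
begin

text \<open>In a graph with gp-number \<open>a\<close>, every vertex \<open>v\<close> has fewer than \<open>R(a,a+1)\<close> neighbours:
  otherwise the neighbourhood of \<open>v\<close> contains an \<open>a\<close>-clique, which together with \<open>v\<close> is an
  \<open>(a+1)\<close>-clique, or \<open>a+1\<close> independent vertices at pairwise distance two; both are in general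
  position. The bound follows by summing degrees. As \<^const>\<open>Max\<close> says nothing about the empty
  set, one also needs a graph of order \<open>n\<close> and gp-number \<open>a\<close>: an \<open>a\<close>-clique with a pendant path.\<close>

section \<open>Detours and shortcuts on geodesics\<close>

lemma geodesic_detour:
  assumes "geodesic V E p" and "i < j" and "j < length p"
    and "set m \<subseteq> V" and "distinct m" and "set m \<inter> set p = {}"
    and "successively (\<lambda>x y. {x, y} \<in> E) (p ! i # m @ [p ! j])"
  shows "j \<le> Suc (i + length m)"
proof -
  let ?adj = "\<lambda>x y. {x, y} \<in> E"
  obtain u v where path: "path_between V E u v p"
    and shortest: "\<And>q. path_between V E u v q \<Longrightarrow> length p \<le> length q"
    using assms(1) unfolding geodesic_def by blast
  have p: "p \<noteq> []" "hd p = u" "last p = v" "set p \<subseteq> V" "distinct p"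
    and edges: "\<And>k. Suc k < length p \<Longrightarrow> ?adj (p ! k) (p ! Suc k)"
    using path unfolding path_between_def by auto
  \<comment> \<open>The stretch of \<open>p\<close> strictly between positions \<open>i\<close> and
    \<open>j\<close> is replaced by \<open>m\<close>. The ends stay the same, so \<open>q\<close>
    cannot be shorter than \<open>p\<close>: the \<open>j - i - 1\<close> vertices removed are at
    most \<open>length m\<close>.\<close>
  define q where "q = take (Suc i) p @ m @ drop j p"
  have last_take: "last (take (Suc i) p) = p ! i"
    using assms by (simp add: take_Suc_conv_app_nth)
  have hd_drop: "hd (drop j p) = p ! j"
    using assms by (simp add: hd_drop_conv_nth)
  have "successively ?adj (take (Suc i) p)" "successively ?adj (drop j p)"
    using edges by (auto simp: successively_conv_nth)
  then have "successively ?adj q"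
    using assms(2,3,7) last_take hd_drop p(1) unfolding q_def
    by (auto simp: successively_append_iff successively_Cons hd_append)
  moreover have "distinct q"
  proof -
    have "set (take (Suc i) p) \<inter> set (drop j p) = {}"
      using p(5) assms(2) by (intro set_take_disj_set_drop_if_distinct) auto
    then show ?thesis
      using p(5) assms(5,6) set_take_subset[of "Suc i" p] set_drop_subset[of j p]
      unfolding q_def by auto
  qed
  moreover have "set q \<subseteq> V"
    using p(4) assms(4) set_take_subset[of "Suc i" p] set_drop_subset[of j p]
    unfolding q_def by auto
  moreover have "q \<noteq> []" "hd q = u" "last q = v"
    using p assms(2,3) unfolding q_def by (auto simp: hd_append)
  ultimately have "path_between V E u v q"
    unfolding path_between_def by (auto simp: successively_conv_nth)
  from shortest[OF this] show ?thesis
    using assms(2,3) unfolding q_def by simp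
qed

lemma geodesic_adjacent:
  assumes "geodesic V E p" and "i < j" and "j < length p" and "{p ! i, p ! j} \<in> E"
  shows "j = Suc i"
  using geodesic_detour[OF assms(1-3), of "[]"] assms by simp

text \<open>Off the geodesic, \<open>v\<close> is itself a one-vertex detour. A detour has to avoid
  \<open>p\<close>, so a \<open>v\<close> on the geodesic is treated separately: adjacency places it
  at most one position away from both \<open>i\<close> and \<open>j\<close>.\<close>

lemma geodesic_common_neighbour:
  assumes "geodesic V E p" and "i < j" and "j < length p" and "v \<in> V"
    and "{v, p ! i} \<in> E" and "{v, p ! j} \<in> E" and "v \<noteq> p ! i" and "v \<noteq> p ! j"
  shows "j \<le> i + 2"
proof (cases "v \<in> set p")
  case True
  then obtain k where k: "k < length p" "v = p ! k"
    by (metis in_set_conv_nth)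
  have near: "k \<le> Suc l \<and> l \<le> Suc k" if "l < length p" "{v, p ! l} \<in> E" for l
    using geodesic_adjacent[OF assms(1), of k l] geodesic_adjacent[OF assms(1), of l k] that k
    by (cases k l rule: linorder_cases) (auto simp: insert_commute)
  show ?thesis
    using near[of i] near[of j] assms by simp
next
  case False
  then show ?thesis
    using geodesic_detour[OF assms(1-3), of "[v]"] assms by (simp add: insert_commute)
qed

lemma geodesic_consecutive:
  assumes "geodesic V E p" and "Suc i < length p"
  shows "{p ! i, p ! Suc i} \<in> E" and "p ! i \<noteq> p ! Suc i"
  using assms unfolding geodesic_def path_between_def
  by (auto simp: nth_eq_iff_index_eq)

section \<open>Sufficient conditions for general position\<close>

lemma nat_set_three_increasing:
  fixes I :: "nat set"
  assumes "finite I" and "2 < card I"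
  obtains i j k where "i \<in> I" "j \<in> I" "k \<in> I" "i < j" "j < k"
proof -
  have "I \<noteq> {}"
    using assms by auto
  moreover have "card {Min I, Max I} \<le> 2"
    by (simp add: card_insert_if)
  then have "\<not> I \<subseteq> {Min I, Max I}"
    using assms(2) card_mono[of "{Min I, Max I}" I] by fastforce
  then obtain j where "j \<in> I" "j \<noteq> Min I" "j \<noteq> Max I"
    by auto
  ultimately show ?thesis
    using that[of "Min I" j "Max I"] assms(1) by (simp add: order_less_le)
qed

text \<open>Trades the cardinality condition for three ordered positions on a geodesic, to which the
  distance estimates above apply. Hence the proof counts positions instead of vertices.\<close>

lemma general_positionI:
  assumes "S \<subseteq> V"
    and "\<And>p i j k. \<lbrakk>geodesic V E p; i < j; j < k; k < length p;
      p ! i \<in> S; p ! j \<in> S; p ! k \<in> S; p ! i \<noteq> p ! j; p ! j \<noteq> p ! k; p ! i \<noteq> p ! k\<rbrakk> \<Longrightarrow> False"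
  shows "general_position V E S"
  unfolding general_position_def
proof (intro conjI allI impI)
  fix p assume geo: "geodesic V E p"
  then have dist: "distinct p"
    unfolding geodesic_def path_between_def by blast
  define I where "I = {i. i < length p \<and> p ! i \<in> S}"
  have "S \<inter> set p = (!) p ` I"
    unfolding I_def by (auto simp: in_set_conv_nth)
  then have le: "card (S \<inter> set p) \<le> card I"
    by (simp add: card_image_le I_def)
  show "card (S \<inter> set p) \<le> 2"
  proof (rule ccontr)
    assume "\<not> card (S \<inter> set p) \<le> 2"
    then have "2 < card I" "finite I"
      using le by (auto simp: I_def)
    then obtain i j k where "i \<in> I" "j \<in> I" "k \<in> I" "i < j" "j < k"
      using nat_set_three_increasing by metis
    then show False
      using assms(2)[OF geo, of i j k] dist by (auto simp: I_def nth_eq_iff_index_eq)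
  qed
qed (rule assms(1))

text \<open>The outer two of three vertices on a geodesic are at least two positions apart, whereas
  adjacent vertices of a geodesic are consecutive.\<close>

lemma general_position_clique:
  assumes "S \<subseteq> V" and "clique S E"
  shows "general_position V E S"
proof (rule general_positionI[OF assms(1)])
  fix p i j k
  assume "geodesic V E p" and "i < j" "j < k" "k < length p"
    and "p ! i \<in> S" "p ! k \<in> S" "p ! i \<noteq> p ! k"
  moreover from this have "{p ! i, p ! k} \<in> E"
    using assms(2) unfolding clique_def by blast
  ultimately show False
    using geodesic_adjacent[of V E p i k] by simp
qed

text \<open>Independence forces gaps of at least two positions, so the outer vertices of a triple
  are at least four apart; their common neighbour \<open>v\<close> allows only two.\<close>

lemma general_position_indep_neighbours:
  assumes "S \<subseteq> V" and "indep S E" and "v \<in> V" and "v \<notin> S" and "\<And>w. w \<in> S \<Longrightarrow> {v, w} \<in> E"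
  shows "general_position V E S"
proof (rule general_positionI[OF assms(1)])
  fix p i j k
  assume geo: "geodesic V E p" and ord: "i < j" "j < k" "k < length p"
    and S: "p ! i \<in> S" "p ! j \<in> S" "p ! k \<in> S"
  have "j \<noteq> Suc i" "k \<noteq> Suc j"
    using geodesic_consecutive[OF geo, of i] geodesic_consecutive[OF geo, of j] ord S assms(2)
    unfolding indep_def by auto
  moreover have "k \<le> i + 2"
    using geodesic_common_neighbour[OF geo, of i k v] ord S assms by auto
  ultimately show False
    using ord by simp
qed

lemma finite_general_position_cards:
  assumes "finite V"
  shows "finite {card S | S. general_position V E S}"
proof (rule finite_subset)
  show "{card S | S. general_position V E S} \<subseteq> {..card V}"
    using assms by (auto simp: general_position_def card_mono)
qed simp

lemma card_le_gp_number:
  assumes "finite V" and "general_position V E S"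
  shows "card S \<le> gp_number V E"
  unfolding gp_number_def
  using finite_general_position_cards[OF assms(1)] assms(2) by (intro Max_ge) auto

section \<open>Ramsey's theorem and vertex degrees\<close>

lemma ramsey_number_exact:
  fixes V :: "nat set"
  assumes "simple_graph V E" and "card V = ramsey_number s t"
  shows "\<exists>S \<subseteq> V. card S = s \<and> clique S E \<or> card S = t \<and> indep S E"
proof -
  let ?P = "\<lambda>N. \<forall>(V :: nat set) E. simple_graph V E \<and> card V = N \<longrightarrow>
     (\<exists>S \<subseteq> V. card S = s \<and> clique S E \<or> card S = t \<and> indep S E)"
  \<comment> \<open>\<open>LEAST\<close> says something only once some number has the property;
    Ramsey's theorem supplies one.\<close>
  obtain r where "\<forall>(V :: nat set) E. finite V \<and> r \<le> card V \<longrightarrow>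
      (\<exists>R \<subseteq> V. card R = s \<and> clique R E \<or> card R = t \<and> indep R E)"
    using ramsey2 by metis
  then have "?P r"
    unfolding simple_graph_def by blast
  then have "?P (ramsey_number s t)"
    unfolding ramsey_number_def by (rule LeastI)
  then show ?thesis
    using assms by blast
qed

text \<open>Prepares for neighbourhoods, which may be larger than the Ramsey number and have edges
  leaving them. Both are handled by passing to a subset \<open>W\<close> of the exact order and to
  the edges inside \<open>W\<close>.\<close>

lemma ramsey_number_le_card:
  fixes V :: "nat set"
  assumes "finite V" and "ramsey_number s t \<le> card V"
  shows "\<exists>S \<subseteq> V. card S = s \<and> clique S E \<or> card S = t \<and> indep S E"
proof -
  obtain W where W: "W \<subseteq> V" "card W = ramsey_number s t" "finite W"
    using obtain_subset_with_card_n[OF assms(2)] by metis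
  have edge: "{x, y} \<in> E \<inter> [W]\<^bsup>2\<^esup> \<longleftrightarrow> {x, y} \<in> E" if "x \<in> W" "y \<in> W" "x \<noteq> y" for x y
    using that by (auto simp: nsets_def)
  have "simple_graph W (E \<inter> [W]\<^bsup>2\<^esup>)"
    using W by (simp add: simple_graph_def)
  from ramsey_number_exact[OF this W(2)] obtain S where S: "S \<subseteq> W"
    "card S = s \<and> clique S (E \<inter> [W]\<^bsup>2\<^esup>) \<or> card S = t \<and> indep S (E \<inter> [W]\<^bsup>2\<^esup>)"
    by blast
  have "clique S (E \<inter> [W]\<^bsup>2\<^esup>) = clique S E" "indep S (E \<inter> [W]\<^bsup>2\<^esup>) = indep S E"
    using edge S(1) unfolding clique_def indep_def by (metis subsetD)+
  then show ?thesis
    using S W(1) by blast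
qed

lemma degree_less_ramsey_number:
  fixes V :: "nat set"
  assumes "simple_graph V E" and "gp_number V E = a" and "v \<in> V"
  shows "card {w \<in> V. {v, w} \<in> E} < ramsey_number a (a + 1)"
proof (rule ccontr)
  assume "\<not> ?thesis"
  moreover have fin: "finite V" and E: "E \<subseteq> [V]\<^bsup>2\<^esup>"
    using assms(1) unfolding simple_graph_def by auto
  \<comment> \<open>Without a loop, \<open>v\<close> lies outside its neighbourhood, so
    \<open>insert v S\<close> below really has one element more than \<open>S\<close>.\<close>
  from E have loop: "{v, v} \<notin> E"
    by (auto simp: nsets_def)
  ultimately obtain S where S: "S \<subseteq> {w \<in> V. {v, w} \<in> E}"
    "card S = a \<and> clique S E \<or> card S = a + 1 \<and> indep S E"
    using ramsey_number_le_card[of "{w \<in> V. {v, w} \<in> E}" a "a + 1" E] fin by auto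
  then have "S \<subseteq> V" "v \<notin> S"
    using loop by auto
  from S(2) show False
  proof
    assume S_clique: "card S = a \<and> clique S E"
    have "clique (insert v S) E"
      using S_clique S(1) unfolding clique_def by (auto simp: insert_commute)
    then have "card (insert v S) \<le> a"
      using card_le_gp_number[OF fin general_position_clique, of "insert v S" E] assms(2,3) \<open>S \<subseteq> V\<close>
      by simp
    then show False
      using S_clique \<open>v \<notin> S\<close> finite_subset[OF \<open>S \<subseteq> V\<close> fin] by simp
  next
    assume S_indep: "card S = a + 1 \<and> indep S E"
    then have "general_position V E S"
      using S(1) \<open>S \<subseteq> V\<close> \<open>v \<notin> S\<close> assms(3) by (intro general_position_indep_neighbours) auto
    from card_le_gp_number[OF fin this] show False
      using S_indep assms(2) by simp
  qed
qed

text \<open>Incidences of vertices with edges are counted twice. For this direction it suffices that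
  \<open>w\<close> \<mapsto> \<open>{v, w}\<close> maps the neighbours of \<open>v\<close> onto the
  edges at \<open>v\<close>.\<close>

lemma sum_degrees:
  assumes "simple_graph V E"
  shows "2 * card E \<le> (\<Sum>v\<in>V. card {w \<in> V. {v, w} \<in> E})"
proof -
  have V: "finite V" and E: "E \<subseteq> [V]\<^bsup>2\<^esup>"
    using assms unfolding simple_graph_def by auto
  then have "finite E"
    using finite_subset finite_imp_finite_nsets by metis
  moreover have "\<forall>e\<in>E. card {v \<in> V. v \<in> e} = 2"
  proof
    fix e assume "e \<in> E"
    then have "e \<subseteq> V" "card e = 2"
      using E by (auto simp: nsets_def)
    moreover from this have "{v \<in> V. v \<in> e} = e"
      by blast
    ultimately show "card {v \<in> V. v \<in> e} = 2"
      by simp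
  qed
  ultimately have "2 * card E = (\<Sum>v\<in>V. card {e \<in> E. v \<in> e})"
    using sum_multicount[OF V, of E "(\<in>)" 2] by simp
  also have "\<dots> \<le> (\<Sum>v\<in>V. card {w \<in> V. {v, w} \<in> E})"
  proof (rule sum_mono)
    fix v
    have "{e \<in> E. v \<in> e} \<subseteq> (\<lambda>w. {v, w}) ` {w \<in> V. {v, w} \<in> E}"
    proof
      fix e assume e: "e \<in> {e \<in> E. v \<in> e}"
      then have "e \<subseteq> V" "card e = 2"
        using E by (auto simp: nsets_def)
      then obtain w where "e = {v, w}"
        using e by (auto simp: card_2_iff doubleton_eq_iff)
      then show "e \<in> (\<lambda>w. {v, w}) ` {w \<in> V. {v, w} \<in> E}"
        using e \<open>e \<subseteq> V\<close> by auto
    qed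
    then show "card {e \<in> E. v \<in> e} \<le> card {w \<in> V. {v, w} \<in> E}"
      using V by (intro surj_card_le) auto
  qed
  finally show ?thesis .
qed

lemma two_size_le:
  fixes V :: "nat set"
  assumes "simple_graph V E" and "gp_number V E = a"
  shows "2 * real (card E) \<le> (real (ramsey_number a (a + 1)) - 1) * real (card V)"
proof -
  let ?R = "ramsey_number a (a + 1)"
  have "2 * real (card E) \<le> (\<Sum>v\<in>V. real (card {w \<in> V. {v, w} \<in> E}))"
    using of_nat_mono[OF sum_degrees[OF assms(1)], where 'a = real] by simp
  \<comment> \<open>The strict inequality between naturals gains the \<open>- 1\<close>, with the
    subtraction taken in the reals.\<close>
  also have "\<dots> \<le> (\<Sum>v\<in>V. real ?R - 1)"
    using degree_less_ramsey_number[OF assms] by (intro sum_mono) fastforce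
  finally show ?thesis
    by (simp add: mult.commute)
qed

section \<open>Lollipop graphs: order \<open>n\<close> and gp-number \<open>a\<close>\<close>

text \<open>The clique is \<open>{..<a}\<close> and the path continues from its last vertex
  \<open>a - 1\<close>, which belongs to both.\<close>

definition lollipop :: "nat \<Rightarrow> nat \<Rightarrow> nat set set" where
  "lollipop a n = {{x, y} | x y. x < y \<and> y < n \<and> (y < a \<or> y = Suc x)}"

lemma lollipop_edge_iff:
  "{x, y} \<in> lollipop a n \<longleftrightarrow>
    x < y \<and> y < n \<and> (y < a \<or> y = Suc x) \<or> y < x \<and> x < n \<and> (x < a \<or> x = Suc y)"
  unfolding lollipop_def by (auto simp: doubleton_eq_iff)

lemma simple_graph_lollipop: "simple_graph {..<n} (lollipop a n)"
  unfolding simple_graph_def lollipop_def by (auto simp: nsets_def)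

text \<open>These geodesics cover the tail from \<open>a - 1\<close> on together with any one
  earlier vertex, which is what limits sets in general position.\<close>

lemma geodesic_lollipop:
  assumes "a \<le> n" and "Suc x < a"
  shows "geodesic {..<n} (lollipop a n) (x # [a - 1..<n])"
  unfolding geodesic_def
proof (intro exI conjI allI impI)
  let ?p = "x # [a - 1..<n]"
  show "path_between {..<n} (lollipop a n) x (n - 1) ?p"
    unfolding path_between_def using assms
    by (auto simp: nth_Cons lollipop_edge_iff split: nat.split)
  fix q assume "path_between {..<n} (lollipop a n) x (n - 1) q"
  then have q: "q \<noteq> []" "hd q = x" "last q = n - 1"
    and edges: "\<And>i. Suc i < length q \<Longrightarrow> {q ! i, q ! Suc i} \<in> lollipop a n"
    unfolding path_between_def by auto
  \<comment> \<open>An edge leads to a number below \<open>a\<close> or raises the number by at most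
    one. From \<open>x\<close> \<le> \<open>a - 2\<close>, reaching \<open>n - 1\<close> thus takes
    at least \<open>n - a + 1\<close> edges, as many as \<open>?p\<close> has.\<close>
  have "q ! i \<le> a - 2 + i" if "i < length q" for i
    using that
  proof (induction i)
    case 0
    then show ?case
      using q assms by (simp add: hd_conv_nth)
  next
    case (Suc i)
    then show ?case
      using edges[of i] assms by (auto simp: lollipop_edge_iff)
  qed
  from this[of "length q - 1"] show "length ?p \<le> length q"
    using q assms by (cases "length q") (auto simp: last_conv_nth)
qed

lemma card_le_of_general_position_lollipop:
  assumes "2 \<le> a" and "a \<le> n" and "general_position {..<n} (lollipop a n) S"
  shows "card S \<le> a"
proof -
  have S: "S \<subseteq> {..<n}" and fin: "finite S"
    using assms(3) finite_subset unfolding general_position_def by auto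
  have le2: "card (S \<inter> insert x {a - 1..<n}) \<le> 2" if "Suc x < a" for x
    using assms(3) geodesic_lollipop[OF assms(2) that] unfolding general_position_def by fastforce
  let ?T = "S \<inter> {a - 1..<n}"
  have split: "card S = card (S \<inter> {..<a - 1}) + card ?T"
  proof -
    have "S = (S \<inter> {..<a - 1}) \<union> ?T"
      using S by auto
    then show ?thesis
      using fin card_Un_disjoint[of "S \<inter> {..<a - 1}" ?T] by fastforce
  qed
  show ?thesis
  \<comment> \<open>With at most one vertex in the tail, the \<open>a - 1\<close> earlier vertices
    leave room for \<open>a\<close> in total. With two or more, an earlier vertex would be a third
    on a common geodesic, so \<open>S\<close> lies in the tail and has at most two elements.\<close>
  proof (cases "card ?T \<le> 1")
    case True
    have "card (S \<inter> {..<a - 1}) \<le> a - 1"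
      using card_mono[of "{..<a - 1}" "S \<inter> {..<a - 1}"] by simp
    then show ?thesis
      using True split assms(1) by simp
  next
    case False
    have "S \<inter> {..<a - 1} = {}"
    proof (rule ccontr)
      assume "S \<inter> {..<a - 1} \<noteq> {}"
      then obtain x where x: "x \<in> S" "Suc x < a"
        by (auto simp: less_diff_conv)
      then have "S \<inter> insert x {a - 1..<n} = insert x ?T" "x \<notin> ?T"
        by auto
      then show False
        using le2[OF x(2)] False fin by simp
    qed
    moreover have "card ?T \<le> 2"
      using le2[of 0] assms(1) card_mono[of "S \<inter> insert 0 {a - 1..<n}" ?T] fin by fastforce
    ultimately show ?thesis
      using split assms(1) by simp
  qed
qed

lemma gp_number_lollipop:
  assumes "2 \<le> a" and "a \<le> n"
  shows "gp_number {..<n} (lollipop a n) = a"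
  unfolding gp_number_def
proof (rule Max_eqI)
  have "general_position {..<n} (lollipop a n) {..<a}"
    using assms by (intro general_position_clique) (auto simp: clique_def lollipop_edge_iff)
  then show "a \<in> {card S | S. general_position {..<n} (lollipop a n) S}"
    by force
qed (use assms in \<open>auto simp: finite_general_position_cards card_le_of_general_position_lollipop\<close>)

theorem theorem3p7:
  fixes a n :: nat
  assumes "a \<ge> 3" and "n \<ge> a"
  shows "real (gex n a) \<le> (real (ramsey_number a (a + 1)) - 1) / 2 * real n"
proof -
  let ?sizes = "{card E | (V :: nat set) E. simple_graph V E \<and> card V = n \<and> gp_number V E = a}"
  let ?b = "(real (ramsey_number a (a + 1)) - 1) / 2 * real n"
  have bound: "real m \<le> ?b" if "m \<in> ?sizes" for m
    using that two_size_le by fastforce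
  \<comment> \<open>\<open>bound\<close> serves twice: here it makes the set of sizes finite, so
    that with nonemptiness the maximum is attained, and at the end it is applied to that
    maximum.\<close>
  have "?sizes \<subseteq> {..nat \<lfloor>?b\<rfloor>}"
    using bound[THEN le_nat_floor] by (intro subsetI) (simp only: atMost_iff)
  then have "finite ?sizes"
    by (rule finite_subset) simp
  moreover have "card (lollipop a n) \<in> ?sizes"
    using simple_graph_lollipop gp_number_lollipop assms by fastforce
  ultimately have "gex n a \<in> ?sizes"
    unfolding gex_def by (intro Max_in) auto
  then show ?thesis
    by (rule bound)
qed

end
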